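(* Let ${\bf n}=n_0n_1n_2\cdots$ be the fixed point starting with $0$ of the morphism $0\mapsto01$, $1\mapsto2$, $2\mapsto0$. For $m\ge1$ let $A_m$ be the least integer $x$ such that every length-$m$ factor of ${\bf n}$ occurs in ${\bf n}$ at some starting position $j\le x$ (positions indexed from $0$). For $i\ge0$ let $D_i=\lfloor (N_i-N_{i+1}+2N_{i+2})/3\rfloor$. Then for every $m\ge2$ and every $i\ge0$ with $D_i<m\le D_{i+1}$, we have $A_m=N_{i+4}-1$.
   Context: The Narayana numbers are defined by $N_0=1$, $N_1=2$, $N_2=3$ and $N_i=N_{i-1}+N_{i-3}$ for $i\ge3$. *)

theory Defs
  imports Complex_Main "HOL-Library.Sublist"
begin

fun N :: "nat \<Rightarrow> nat" where
  "N 0 = 1"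
| "N (Suc 0) = 2"
| "N (Suc (Suc 0)) = 3"
| "N (Suc (Suc (Suc i))) = N (Suc (Suc i)) + N i"

definition D :: "nat \<Rightarrow> int" where
  "D i = \<lfloor>(real (N i) - real (N (i + 1)) + 2 * real (N (i + 2))) / 3\<rfloor>"

text \<open>
  Infinite words are functions on \<^typ>\<open>nat\<close>; \<open>factor w j m\<close> is the length-\<open>m\<close> factor
  of \<open>w\<close> starting at position \<open>j\<close>.
\<close>

definition factor :: "(nat \<Rightarrow> 'a) \<Rightarrow> nat \<Rightarrow> nat \<Rightarrow> 'a list" where
  "factor w j m = map w [j..<j + m]"

definition apply_morphism :: "('a \<Rightarrow> 'b list) \<Rightarrow> 'a list \<Rightarrow> 'b list" where
  "apply_morphism h u = concat (map h u)"

text \<open>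
  The image of an infinite word under a non-erasing morphism is the infinite word whose
  prefixes include the images of all finite prefixes. Hence \<open>h(w) = w\<close> says that the image of
  every prefix of \<open>w\<close> is again a prefix of \<open>w\<close>. (For erasing morphisms this would be too weak.)
\<close>

definition is_fixed_point :: "('a \<Rightarrow> 'a list) \<Rightarrow> (nat \<Rightarrow> 'a) \<Rightarrow> bool" where
  "is_fixed_point h w \<longleftrightarrow>
     (\<forall>k. let u = apply_morphism h (factor w 0 k) in u = factor w 0 (length u))"

datatype letter = L0 | L1 | L2

fun narayana_morphism :: "letter \<Rightarrow> letter list" where
  "narayana_morphism L0 = [L0, L1]"
| "narayana_morphism L1 = [L2]"
| "narayana_morphism L2 = [L0]"

definition appearance :: "(nat \<Rightarrow> 'a) \<Rightarrow> nat \<Rightarrow> nat" where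
  "appearance w m =
     (LEAST x. \<forall>u \<in> range (\<lambda>k. factor w k m). \<exists>j\<le>x. factor w j m = u)"

text \<open>
  Over a finite alphabet the set of bounds in \<open>appearance\<close> is nonempty, so \<open>LEAST\<close> denotes
  an actual minimum.
\<close>

lemma appearance_bound_exists:
  fixes w :: "nat \<Rightarrow> letter"
  shows "\<exists>x. \<forall>u \<in> range (\<lambda>k. factor w k m). \<exists>j\<le>x. factor w j m = u"
proof -
  let ?F = "range (\<lambda>k. factor w k m)"
  have "(UNIV :: letter set) = {L0, L1, L2}"
    using letter.exhaust by auto
  then have "finite (UNIV :: letter set)"
    by (metis finite.emptyI finite.insertI)
  then have "finite {xs :: letter list. set xs \<subseteq> UNIV \<and> length xs = m}"
    by (rule finite_lists_length_eq)
  moreover have "?F \<subseteq> {xs. set xs \<subseteq> UNIV \<and> length xs = m}"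
    by (auto simp: factor_def)
  ultimately have fin: "finite ?F"
    by (rule rev_finite_subset)
  define f where "f u = (SOME j. factor w j m = u)" for u
  have f: "factor w (f u) m = u" if "u \<in> ?F" for u
    using that unfolding f_def by (auto intro: someI)
  have "\<forall>u\<in>?F. f u \<le> Max (f ` ?F) \<and> factor w (f u) m = u"
    using fin f by auto
  then show ?thesis by blast
qed

lemma apply_morphism_append [simp]:
  "apply_morphism h (u @ v) = apply_morphism h u @ apply_morphism h v"
  by (simp add: apply_morphism_def)

lemma apply_morphism_mono: "prefix u v \<Longrightarrow> prefix (apply_morphism h u) (apply_morphism h v)"
  by (auto simp: prefix_def)

lemma factor_take: "k \<le> m \<Longrightarrow> take k (factor w 0 m) = factor w 0 k"
  by (simp add: factor_def take_map)

lemma length_factor [simp]: "length (factor w j m) = m"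
  by (simp add: factor_def)

abbreviation narayana_iterate :: "nat \<Rightarrow> letter list" where
  "narayana_iterate k \<equiv> (apply_morphism narayana_morphism ^^ k) [L0]"

lemma iterate_append:
  fixes h :: "'a \<Rightarrow> 'a list"
  shows "(apply_morphism h ^^ k) (u @ v) = (apply_morphism h ^^ k) u @ (apply_morphism h ^^ k) v"
proof (induction k)
  case (Suc k)
  then show ?case by simp
qed simp

lemma narayana_iterate_Suc:
  "narayana_iterate (Suc k) = narayana_iterate k @ (apply_morphism narayana_morphism ^^ k) [L1]"
proof -
  have "narayana_iterate (Suc k) = (apply_morphism narayana_morphism ^^ k) ([L0] @ [L1])"
    by (simp only: funpow_Suc_right comp_apply) (simp add: apply_morphism_def)
  then show ?thesis by (simp only: iterate_append)
qed

lemma narayana_image_nonempty: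
  "u \<noteq> [] \<Longrightarrow> apply_morphism narayana_morphism u \<noteq> []"
proof (cases u)
  case (Cons a v)
  then show ?thesis by (cases a) (auto simp: apply_morphism_def)
qed simp

lemma narayana_iterate_nonempty: "(apply_morphism narayana_morphism ^^ k) [a] \<noteq> []"
  by (induction k) (auto simp: narayana_image_nonempty)

lemma narayana_iterate_length: "k < length (narayana_iterate k)"
proof (induction k)
  case (Suc k)
  have "0 < length ((apply_morphism narayana_morphism ^^ k) [L1])"
    using narayana_iterate_nonempty by blast
  with Suc show ?case unfolding narayana_iterate_Suc length_append by linarith
qed simp

lemma narayana_iterate_prefix: "i \<le> k \<Longrightarrow> prefix (narayana_iterate i) (narayana_iterate k)"
proof (induction k rule: dec_induct)
  case (step k)
  show ?case unfolding narayana_iterate_Suc using step.IH by (rule prefix_prefix)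
qed simp

text \<open>The fixed point starting with \<open>0\<close> exists and is unique.\<close>

lemma narayana_fixed_point_ex1: "\<exists>!w. is_fixed_point narayana_morphism w \<and> w 0 = L0"
proof (rule ex_ex1I)
  define w where "w j = narayana_iterate j ! j" for j
  have w_nth: "narayana_iterate k ! j = w j" if "j < length (narayana_iterate k)" for j k
  proof (cases "j \<le> k")
    case True
    then show ?thesis
      using narayana_iterate_prefix[OF True] narayana_iterate_length[of j]
      by (auto simp: w_def prefix_def nth_append)
  next
    case False
    then have "k \<le> j" by simp
    from narayana_iterate_prefix[OF this] that show ?thesis
      by (auto simp: w_def prefix_def nth_append)
  qed
  have pre: "u = factor w 0 (length u)" if "prefix u (narayana_iterate k)" for u k
  proof (rule nth_equalityI)
    fix i assume i: "i < length u"
    with that have "i < length (narayana_iterate k)" "u ! i = narayana_iterate k ! i"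
      by (auto simp: prefix_def nth_append)
    then show "u ! i = factor w 0 (length u) ! i"
      using w_nth i by (simp add: factor_def)
  qed simp
  have "is_fixed_point narayana_morphism w"
    unfolding is_fixed_point_def Let_def
  proof
    fix k
    have "take k (narayana_iterate k) = take k (factor w 0 (length (narayana_iterate k)))"
      using pre[of "narayana_iterate k" k] by simp
    then have "factor w 0 k = take k (narayana_iterate k)"
      using narayana_iterate_length[of k] by (simp add: factor_take)
    then have "prefix (factor w 0 k) (narayana_iterate k)"
      by (simp add: take_is_prefix)
    then have "prefix (apply_morphism narayana_morphism (factor w 0 k)) (narayana_iterate (Suc k))"
      using apply_morphism_mono by simp
    then show "apply_morphism narayana_morphism (factor w 0 k) =
        factor w 0 (length (apply_morphism narayana_morphism (factor w 0 k)))"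
      by (rule pre)
  qed
  moreover have "w 0 = L0" by (simp add: w_def)
  ultimately show "\<exists>w. is_fixed_point narayana_morphism w \<and> w 0 = L0" by blast
next
  fix v w
  assume v: "is_fixed_point narayana_morphism v \<and> v 0 = L0"
    and w: "is_fixed_point narayana_morphism w \<and> w 0 = L0"
  have it: "narayana_iterate k = factor x 0 (length (narayana_iterate k))"
    if "is_fixed_point narayana_morphism x \<and> x 0 = L0" for x k
  proof (induction k)
    case 0
    then show ?case using that by (simp add: factor_def)
  next
    case (Suc k)
    then have "narayana_iterate (Suc k) =
        apply_morphism narayana_morphism (factor x 0 (length (narayana_iterate k)))"
      by simp
    then show ?case using that
      unfolding is_fixed_point_def Let_def by (simp del: funpow.simps)
  qed
  have nth: "x j = narayana_iterate j ! j"
    if "is_fixed_point narayana_morphism x \<and> x 0 = L0" for x j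
  proof -
    have "narayana_iterate j ! j = factor x 0 (length (narayana_iterate j)) ! j"
      using it[OF that, of j] by simp
    also have "\<dots> = x j"
      using narayana_iterate_length[of j] by (simp add: factor_def)
    finally show ?thesis by simp
  qed
  show "v = w"
    using nth[OF v] nth[OF w] by auto
qed

end

theory Submission
  imports Defs
begin

text \<open>
  Cut \<open>n\<close> into the level-\<open>k\<close> blocks \<open>\<phi>\<^sup>k(n\<^sub>0), \<phi>\<^sup>k(n\<^sub>1), \<dots>\<close>. What follows any block boundary of level
  \<open>i + 1\<close> agrees with \<open>n\<close> itself on exactly \<open>D\<^sub>i - 1\<close> letters if the next block is \<open>\<phi>\<^sup>i\<^sup>+\<^sup>1(1)\<close>, and on
  at least one letter more otherwise. Hence a factor of length at most \<open>D\<^sub>i\<^sub>+\<^sub>1\<close> is determined by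
  the letter indexing the level-\<open>(i + 2)\<close> block in which it starts and by its offset there, so it
  already starts inside \<open>\<phi>\<^sup>i\<^sup>+\<^sup>2(012)\<close>, which has length \<open>N\<^sub>i\<^sub>+\<^sub>4\<close>.

  Conversely, the last letter of \<open>\<phi>\<^sup>i\<^sup>+\<^sup>1(0)\<close> followed by the prefix of \<open>n\<close> of length \<open>D\<^sub>i\<close> occurs only
  across the boundary between two consecutive blocks \<open>\<phi>\<^sup>i\<^sup>+\<^sup>1(0)\<close>. Since \<open>n\<close> starts with \<open>01200\<close>, the
  first such boundary is at \<open>|\<phi>\<^sup>i\<^sup>+\<^sup>1(0120)| = N\<^sub>i\<^sub>+\<^sub>4\<close>.
\<close>

section \<open>Last letters and lengths of images of the morphism\<close>

fun last_image :: "letter \<Rightarrow> letter" where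
  "last_image L0 = L1"
| "last_image L1 = L2"
| "last_image L2 = L0"

text \<open>As the three images end in different letters, the letter just before an image boundary
  reveals the letter whose image ended there.\<close>

lemma inj_last_image: "last_image a = last_image b \<longleftrightarrow> a = b"
  by (cases a; cases b) auto

text \<open>This is |phi^k(a)|, computed by phi^(k+1)(a) = phi^k(phi(a)).\<close>

fun block_length :: "nat \<Rightarrow> letter \<Rightarrow> nat" where
  "block_length 0 a = 1"
| "block_length (Suc k) L0 = block_length k L0 + block_length k L1"
| "block_length (Suc k) L1 = block_length k L2"
| "block_length (Suc k) L2 = block_length k L0"

lemma block_length_pos: "0 < block_length k a"
  by (induction k a rule: block_length.induct) auto

lemma block_length_L0: "block_length k L0 = N k"
  by (induction k rule: N.induct) (simp_all add: numeral_eq_Suc)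

lemma ex_block:
  assumes "strict_mono f" and "f 0 = (0::nat)"
  shows "\<exists>t. f t \<le> j \<and> j < f (Suc t)"
proof (induction j)
  case 0
  show ?case using assms strict_monoD[OF assms(1), of 0 1] by (intro exI[of _ 0]) auto
next
  case (Suc j)
  then obtain t where t: "f t \<le> j" "j < f (Suc t)" by blast
  have "f (Suc t) < f (Suc (Suc t))" using assms strict_mono_Suc_iff by blast
  then show ?case using t by (cases "Suc j < f (Suc t)") (auto intro: exI[of _ t] exI[of _ "Suc t"])
qed

section \<open>Positions of images in the fixed point\<close>

locale narayana_word =
  fixes n :: "nat \<Rightarrow> letter"
  assumes fixed_point: "is_fixed_point narayana_morphism n" and start: "n 0 = L0"
begin

text \<open>The image of letter \<open>t\<close> starts here. The morphism carries boundaries to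
  boundaries, so the iterate \<open>block_start k t\<close> is where phi^k(n_t) starts.\<close>

definition pos :: "nat \<Rightarrow> nat" where
  "pos t = length (apply_morphism narayana_morphism (factor n 0 t))"

abbreviation block_start :: "nat \<Rightarrow> nat \<Rightarrow> nat" where
  "block_start k \<equiv> pos ^^ k"

lemma image_prefix: "apply_morphism narayana_morphism (factor n 0 t) = factor n 0 (pos t)"
  using fixed_point unfolding is_fixed_point_def Let_def pos_def by blast

lemma factor_Suc: "factor n 0 (Suc t) = factor n 0 t @ [n t]"
  by (simp add: factor_def)

lemma pos_0 [simp]: "pos 0 = 0"
  by (simp add: pos_def factor_def apply_morphism_def)

lemma pos_Suc: "pos (Suc t) = pos t + length (narayana_morphism (n t))"
  by (simp add: pos_def factor_Suc) (simp add: apply_morphism_def)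

lemma nth_pos_add:
  assumes "u < length (narayana_morphism (n t))"
  shows "n (pos t + u) = narayana_morphism (n t) ! u"
proof -
  have "factor n 0 (pos (Suc t)) = factor n 0 (pos t) @ narayana_morphism (n t)"
    unfolding image_prefix[symmetric] by (simp add: factor_Suc) (simp add: apply_morphism_def)
  then have "factor n 0 (pos (Suc t)) ! (pos t + u) = narayana_morphism (n t) ! u"
    by (simp add: nth_append)
  then show ?thesis
    using assms by (simp add: factor_def pos_Suc)
qed

lemma pos_Suc_L0: "n t = L0 \<Longrightarrow> pos (Suc t) = Suc (Suc (pos t))"
  and pos_Suc_other: "n t \<noteq> L0 \<Longrightarrow> pos (Suc t) = Suc (pos t)"
  by (cases "n t"; simp add: pos_Suc)+

lemma nth_pos: "n (pos t) = (if n t = L1 then L2 else L0)"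
  using nth_pos_add[of 0 t] by (cases "n t") auto

lemma nth_Suc_pos_L0: "n t = L0 \<Longrightarrow> n (Suc (pos t)) = L1"
  using nth_pos_add[of 1 t] by auto

lemma pos_less_Suc: "pos t < pos (Suc t)"
  by (cases "n t") (auto simp: pos_Suc)

lemma strict_mono_pos: "strict_mono pos"
  by (simp add: strict_mono_Suc_iff pos_less_Suc)

lemma strict_mono_block_start: "strict_mono (block_start k)"
  by (induction k) (auto simp: strict_mono_def strict_mono_less[OF strict_mono_pos])

lemma block_start_0 [simp]: "block_start k 0 = 0"
  by (induction k) auto

lemma position_cases:
  obtains (first) t where "j = pos t"
  | (second) t where "j = Suc (pos t)" "n t = L0"
proof -
  obtain t where t: "pos t \<le> j" "j < pos (Suc t)"
    using ex_block[OF strict_mono_pos pos_0] by blast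
  show ?thesis
  proof (cases "j = pos t")
    case False
    then have "n t = L0" using t by (cases "n t") (auto simp: pos_Suc)
    with False t show ?thesis using second[of t] by (simp add: pos_Suc)
  qed (rule first)
qed

section \<open>Desubstitution of single letters and possible neighbours\<close>

lemma L0_position: assumes "n j = L0" obtains t where "j = pos t"
  using assms nth_Suc_pos_L0 by (cases j rule: position_cases) auto

lemma L1_position: assumes "n j = L1" obtains t where "j = Suc (pos t)" "n t = L0"
  using assms nth_pos by (cases j rule: position_cases) (auto split: if_splits)

lemma after_L1: "n j = L1 \<Longrightarrow> n (Suc j) \<noteq> L1"
  by (metis L1_position letter.distinct nth_pos pos_Suc_L0)

lemma before_L1: "n (Suc j) = L1 \<Longrightarrow> n j = L0"
  by (metis L1_position Suc_inject letter.distinct(1) nth_pos)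

lemma L2_position: assumes "n j = L2" obtains t where "j = pos t" "n t = L1"
  using assms nth_pos nth_Suc_pos_L0 by (cases j rule: position_cases) (auto split: if_splits)

lemma after_L2: "n j = L2 \<Longrightarrow> n (Suc j) = L0"
  by (metis L2_position after_L1 letter.distinct(1) nth_pos pos_Suc_other)

lemma before_L2: assumes "n (Suc j) = L2" shows "n j = L1"
proof -
  obtain t where t: "Suc j = pos t" "n t = L1" using assms L2_position by blast
  then obtain r where r: "t = Suc r" by (cases t) auto
  then have "n r = L0" using t before_L1 by blast
  then show ?thesis using t r pos_Suc_L0 nth_Suc_pos_L0 by simp
qed

lemma nth_Suc_pos_L2: assumes "n t = L2" shows "n (Suc (pos t)) = L0"
  using assms nth_pos[of "Suc t"] after_L2 pos_Suc_other[of t] by simp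

lemma last_of_image: "n (pos (Suc t) - 1) = last_image (n t)"
  using nth_pos nth_Suc_pos_L0 pos_Suc_L0 pos_Suc_other by (cases "n t") simp_all

section \<open>Lengths and contents of the blocks\<close>

lemma block_start_Suc: "block_start k (Suc t) = block_start k t + block_length k (n t)"
proof (induction k arbitrary: t)
  case (Suc k)
  \<comment> \<open>Splitting off the innermost \<open>pos\<close> turns a
    level-\<open>Suc k\<close> block into one or two consecutive level-\<open>k\<close>
    blocks.\<close>
  have eq: "block_start (Suc k) x = block_start k (pos x)" for x
    by (simp add: funpow_swap1)
  show ?case
    unfolding eq using Suc nth_pos[of t] nth_Suc_pos_L0[of t]
    by (cases "n t") (simp_all add: pos_Suc)
qed simp

lemma prefix_letters: "n 0 = L0" "n 1 = L1" "n 2 = L2" "n 3 = L0" "n 4 = L0"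
proof -
  show 0: "n 0 = L0" by (rule start)
  show 1: "n 1 = L1" using nth_Suc_pos_L0[OF 0] by simp
  have p1: "pos 1 = 2" using pos_Suc_L0[OF 0] by simp
  show 2: "n 2 = L2" using nth_pos[of 1] 1 p1 by simp
  have p2: "pos 2 = 3" using pos_Suc_other[of 1] 1 p1 by (simp add: numeral_2_eq_2)
  show 3: "n 3 = L0" using nth_pos[of 2] 2 p2 by simp
  have p3: "pos 3 = 4" using pos_Suc_other[of 2] 2 p2 by (simp add: numeral_3_eq_3)
  show 4: "n 4 = L0" using nth_pos[of 3] 3 p3 by simp
qed

text \<open>The prefixes 0, 012 and 0120 of \<open>n\<close> are phi^0(0), phi^2(0) and phi^3(0), so
  their level-\<open>k\<close> images are again iterates of 0.\<close>

lemma block_start_values: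
  "block_start k 1 = N k" "block_start k 3 = N (k + 2)" "block_start k 4 = N (k + 3)"
proof -
  have *: "block_length k L1 + N k = N (Suc k)" "block_length k L2 + N (Suc k) = N (Suc (Suc k))"
    using block_length_L0[of "Suc k"] block_length_L0[of "Suc (Suc k)"] block_length_L0[of k]
    by simp_all
  have 1: "block_start k 1 = N k"
    using block_start_Suc[of k 0] start by (simp add: block_length_L0)
  have "block_start k (Suc 1) = N (Suc k)"
    using block_start_Suc[of k 1] prefix_letters 1 * by simp
  then have 3: "block_start k (Suc 2) = N (Suc (Suc k))"
    using block_start_Suc[of k 2] prefix_letters * by (simp add: numeral_2_eq_2)
  have "block_start k (Suc 3) = N (Suc (Suc (Suc k)))"
    using block_start_Suc[of k 3] prefix_letters 3
    by (simp add: numeral_3_eq_3 numeral_2_eq_2 block_length_L0)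
  with 1 3 show "block_start k 1 = N k" "block_start k 3 = N (k + 2)" "block_start k 4 = N (k + 3)"
    by (simp_all add: numeral_eq_Suc)
qed

lemma nth_block_eq:
  assumes "n t = n t'" and "u < block_length k (n t)"
  shows "n (block_start k t + u) = n (block_start k t' + u)"
  using assms
proof (induction k arbitrary: t t' u)
  case (Suc k)
  have eq: "block_start (Suc k) x = block_start k (pos x)" for x
    by (simp add: funpow_swap1)
  have first: "n (pos t) = n (pos t')"
    using Suc.prems(1) by (simp add: nth_pos)
  show ?case
  proof (cases "u < block_length k (n (pos t))")
    case True
    then show ?thesis unfolding eq using Suc.IH first by blast
  next
    case False
    have t: "n t = L0"
      using False Suc.prems(2) nth_pos[of t] by (cases "n t") auto
    have u: "u - block_length k L0 < block_length k (n (Suc (pos t)))"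
      using False Suc.prems t nth_pos[of t] nth_Suc_pos_L0[OF t] block_length_pos[of k L1] by auto
    have "n (block_start k (Suc (pos t)) + (u - block_length k L0))
        = n (block_start k (Suc (pos t')) + (u - block_length k L0))"
      by (rule Suc.IH) (use u t Suc.prems nth_Suc_pos_L0 in auto)
    then show ?thesis
      unfolding eq block_start_Suc using False t Suc.prems nth_pos by simp
  qed
qed simp

lemma last_of_block: "n (block_start k (Suc t) - 1) = (last_image ^^ k) (n t)"
proof (induction k arbitrary: t)
  case (Suc k)
  have gt: "0 < block_start k (Suc t)"
    using strict_monoD[OF strict_mono_block_start[of k], of 0 "Suc t"] by simp
  then obtain r where r: "block_start k (Suc t) = Suc r" using gr0_implies_Suc by blast
  show ?case using Suc[of t] last_of_image[of r] r by simp
qed simp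

section \<open>Common prefixes of the word and its continuations at boundaries\<close>

lemma pos_add:
  assumes "\<And>u. u < s \<Longrightarrow> n (r + u) = n u"
  shows "pos (r + s) = pos r + pos s"
  using assms by (induction s) (simp_all add: pos_Suc)

lemma nth_pos_agree:
  assumes "\<And>u. u < s \<Longrightarrow> n (r + u) = n u" and "v < pos s"
  shows "n (pos r + v) = n v"
proof -
  obtain t where t: "pos t \<le> v" "v < pos (Suc t)"
    using ex_block[OF strict_mono_pos pos_0] by blast
  have "t < s"
    using t assms(2) strict_mono_less[OF strict_mono_pos, of t s] by simp
  then have add: "pos (r + t) = pos r + pos t" and eq: "n (r + t) = n t"
    using assms(1) by (auto intro: pos_add)
  have v: "v - pos t < length (narayana_morphism (n t))"
    using t by (simp add: pos_Suc)
  show ?thesis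
    using nth_pos_add[of "v - pos t" t] nth_pos_add[of "v - pos t" "r + t"] v eq add t by simp
qed

text \<open>The two letters that can follow the common prefix alternate between \<open>{0, 2}\<close>, whose images
  share their first letter, and \<open>{0, 1}\<close>, whose images do not; hence the parity term.\<close>

fun agreement :: "nat \<Rightarrow> nat" where
  "agreement 0 = 0"
| "agreement (Suc i) = pos (agreement i) + (if even i then 1 else 0)"

definition mismatch_letters :: "nat \<Rightarrow> letter set" where
  "mismatch_letters i = (if even i then {L0, L2} else {L0, L1})"

text \<open>The morphism maps a common prefix to a common prefix and keeps a mismatch a mismatch;
  knowing the next letter up to two candidates determines how many letters are gained.\<close>

lemma block_agreement:
  "(\<forall>s < agreement i. n (block_start (Suc i) t + s) = n s) \<and>
   n (block_start (Suc i) t + agreement i) \<in> mismatch_letters i \<and>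
   (n (block_start (Suc i) t + agreement i) = n (agreement i) \<longleftrightarrow> n t \<noteq> L1)"
proof (induction i arbitrary: t)
  case 0
  show ?case using nth_pos[of t] start by (simp add: mismatch_letters_def)
next
  case (Suc i)
  define r where "r = block_start (Suc i) t"
  define e where "e = agreement i"
  have agr: "\<And>s. s < e \<Longrightarrow> n (r + s) = n s"
    and mem: "n (r + e) \<in> mismatch_letters i"
    and iff: "n (r + e) = n e \<longleftrightarrow> n t \<noteq> L1"
    using Suc[of t] unfolding r_def e_def by auto
  have mem0: "n e \<in> mismatch_letters i"
    using Suc[of 0] unfolding e_def by simp
  have r': "block_start (Suc (Suc i)) t = pos r" by (simp add: r_def)
  have add: "pos (r + e) = pos r + pos e" using agr by (rule pos_add)
  have agr': "\<And>s. s < pos e \<Longrightarrow> n (pos r + s) = n s"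
    using nth_pos_agree agr by blast
  show ?case
  proof (cases "even i")
    case True
    then have e': "agreement (Suc i) = Suc (pos e)" by (simp add: e_def)
    have cs: "n e \<in> {L0, L2}" "n (r + e) \<in> {L0, L2}"
      using mem mem0 True by (auto simp: mismatch_letters_def)
    have "n (pos r + pos e) = n (pos e)"
      using cs nth_pos[of e] nth_pos[of "r + e"] add by auto
    then have "\<forall>s < Suc (pos e). n (pos r + s) = n s"
      using agr' less_Suc_eq by auto
    \<comment> \<open>A 2 is followed by a 0, whose image starts with 0. So the images of 0 and 2
      continue as 01 and 00, and the mismatch moves one letter on.\<close>
    moreover have "n (Suc (pos x)) = (if n x = L0 then L1 else L0)" if "n x \<in> {L0, L2}" for x
      using that nth_Suc_pos_L0 nth_Suc_pos_L2 by auto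
    then have "n (Suc (pos e)) = (if n e = L0 then L1 else L0)"
      "n (pos r + Suc (pos e)) = (if n (r + e) = L0 then L1 else L0)"
      using cs add by (metis, metis add_Suc_right)
    ultimately show ?thesis
      unfolding r' e' using cs True iff by (auto simp: mismatch_letters_def)
  next
    case False
    then have e': "agreement (Suc i) = pos e" by (simp add: e_def)
    have cs: "n e \<in> {L0, L1}" "n (r + e) \<in> {L0, L1}"
      using mem mem0 False by (auto simp: mismatch_letters_def)
    then show ?thesis
      unfolding r' e' using agr' False iff nth_pos[of e] nth_pos[of "r + e"] add
      by (auto simp: mismatch_letters_def)
  qed
qed

lemma agreement_letter: "n (agreement i) \<in> mismatch_letters i"
  using block_agreement[of i 0] by simp

section \<open>Recognizability of boundaries\<close>

lemma before_odd_agreement: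
  assumes "odd i"
  obtains s where "agreement i = Suc s" "n s = L0"
proof -
  obtain j where j: "i = Suc j" "even j" using assms by (cases i) auto
  \<comment> \<open>At level \<open>j\<close> the candidates are 0 and 2; the first letter 0 shared
    by their images ends the longer common prefix.\<close>
  have "n (pos (agreement j)) = L0"
    using agreement_letter[of j] j nth_pos by (auto simp: mismatch_letters_def)
  then show ?thesis using j that by simp
qed

text \<open>The morphism is undone once per level: a 0 always begins an image,
  \<open>last_image\<close> recovers the letter before it, and agreement with the prefix descends.
  The bound is \<open>\<le>\<close>, so the mismatch letter is compared too and excludes a following
  block of 1.\<close>

lemma recognizability:
  assumes "n q = (last_image ^^ Suc i) L0" and "\<forall>s \<le> agreement i. n (Suc q + s) = n s"
  shows "\<exists>t. Suc q = block_start (Suc i) (Suc t) \<and> n t = L0 \<and> n (Suc t) \<noteq> L1"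
  using assms
proof (induction i arbitrary: q)
  case 0
  then have "n q = L1" and q1: "n (Suc q) = L0" using start by auto
  then obtain t where t: "q = Suc (pos t)" "n t = L0" using L1_position by blast
  then have "Suc q = pos (Suc t)" by (simp add: pos_Suc_L0)
  moreover from this have "n (Suc t) \<noteq> L1" using q1 nth_pos[of "Suc t"] by auto
  ultimately show ?case using t by auto
next
  case (Suc i)
  let ?e = "agreement i"
  have agr: "n (Suc q + s) = n s" if "s \<le> agreement (Suc i)" for s
    using Suc.prems(2) that by blast
  have "n (Suc q) = L0" using agr[of 0] start by simp
  then obtain r where r: "Suc q = pos r" using L0_position by blast
  then obtain p where p: "r = Suc p" by (cases r) auto
  have "last_image (n p) = last_image ((last_image ^^ Suc i) L0)"
    using last_of_image[of p] Suc.prems(1) r p by (metis diff_Suc_1 funpow.simps(2) comp_apply)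
  then have np: "n p = (last_image ^^ Suc i) L0" by (simp only: inj_last_image)
  have "n (r + s) = n s" if "s \<le> ?e" for s
    using that
  proof (induction s rule: less_induct)
    case (less s)
    have prev: "\<And>u. u < s \<Longrightarrow> n (r + u) = n u" using less by simp
    have add: "pos (r + s) = pos r + pos s" using prev by (rule pos_add)
    have "pos s \<le> pos ?e" using less.prems strict_mono_less_eq[OF strict_mono_pos] by blast
    then have le: "pos s \<le> agreement (Suc i)" by simp
    have "n (pos (r + s)) = n (pos s)" using agr[OF le] r add by simp
    \<comment> \<open>Only the image of 1 starts with 2, so only 0 and 2 could still be
      confused.\<close>
    then have one: "n (r + s) = L1 \<longleftrightarrow> n s = L1" by (simp add: nth_pos split: if_splits)
    show ?case
    proof (rule ccontr)
      assume neq: "n (r + s) \<noteq> n s"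
      then have cs: "n (r + s) = L0 \<and> n s = L2 \<or> n (r + s) = L2 \<and> n s = L0"
        using one by (cases "n (r + s)"; cases "n s") auto
      show False
      proof (cases "s < ?e \<or> even i")
        case True
        \<comment> \<open>The letter after the shared 0 is still in the compared range; it is 1 for
          the letter 0 and 0 for the letter 2.\<close>
        have "Suc (pos s) \<le> agreement (Suc i)"
        proof (cases "s < ?e")
          case True
          then have "pos s < pos ?e" using strict_monoD[OF strict_mono_pos] by blast
          then show ?thesis by simp
        next
          case False
          then show ?thesis using True less.prems by simp
        qed
        then have "n (Suc (pos (r + s))) = n (Suc (pos s))" using agr[of "Suc (pos s)"] r add by simp
        then show False using cs nth_Suc_pos_L0 nth_Suc_pos_L2 by force
      next
        case False
        \<comment> \<open>Here the next letter is out of range, so the argument looks left: a 2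
          needs a 1 before it, but the prefix has a 0 there.\<close>
        then have s: "s = ?e" and odd: "odd i" using less.prems by auto
        then have "n s \<noteq> L2" using agreement_letter[of i] by (auto simp: mismatch_letters_def)
        then have 2: "n (r + s) = L2" using cs by auto
        obtain u where u: "s = Suc u" "n u = L0" using before_odd_agreement[OF odd] s by metis
        then have "n (r + u) = L1" using 2 before_L2 by simp
        then show False using u prev[of u] by simp
      qed
    qed
  qed
  then obtain t where t: "Suc p = block_start (Suc i) (Suc t)" "n t = L0" "n (Suc t) \<noteq> L1"
    using Suc.IH[OF np] p by blast
  then have "Suc q = block_start (Suc (Suc i)) (Suc t)" using r p by simp
  then show ?case using t by blast
qed

section \<open>Closed form of the agreement length\<close>

lemma pos_values: "pos (Suc 0) = 2" "pos 2 = 3" "pos 4 = 6"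
  using block_start_values(1,3)[of 1] block_start_values(1)[of 2] by (simp_all add: numeral_eq_Suc)

text \<open>The common prefix follows the boundary before block 4, so \<open>pos\<close> is additive
  across it; the parity term is the same at \<open>i\<close> and \<open>i + 4\<close>.\<close>

lemma agreement_add_4: "agreement (i + 4) = block_start (Suc i) 4 + agreement i"
proof (induction i)
  case 0
  have "agreement 2 = 2" using pos_values by (simp add: numeral_2_eq_2)
  then have "agreement 3 = 4" using agreement.simps(2)[of 2] pos_values by simp
  then have "agreement 4 = 6" using agreement.simps(2)[of 3] pos_values by simp
  then show ?case using pos_values by simp
next
  case (Suc i)
  have "pos (block_start (Suc i) 4 + agreement i) = pos (block_start (Suc i) 4) + pos (agreement i)"
    using block_agreement[of i 4] by (intro pos_add) auto
  then show ?case using Suc agreement.simps(2)[of "i + 4"] by simp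
qed

text \<open>Both sides grow by \<open>N (i + 4)\<close> from \<open>i\<close> to
  \<open>i + 4\<close>: the numerator in \<open>D\<close> grows by exactly three times that, so the
  floor is harmless. Hence the induction carries four consecutive values.\<close>

lemma D_eq_agreement: "D i = int (agreement i) + 1"
proof -
  have D: "D i = (int (N i) - int (N (i + 1)) + 2 * int (N (i + 2))) div 3" for i
    using floor_divide_of_int_eq[of "int (N i) - int (N (i + 1)) + 2 * int (N (i + 2))" 3,
        where ?'a = real]
    unfolding D_def by simp
  have "D i = int (agreement i) + 1 \<and> D (i + 1) = int (agreement (i + 1)) + 1 \<and>
    D (i + 2) = int (agreement (i + 2)) + 1 \<and> D (i + 3) = int (agreement (i + 3)) + 1"
  proof (induction i)
    case 0
    show ?case using pos_values by (simp add: D eval_nat_numeral)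
  next
    case (Suc i)
    have "int (N (i + 4)) - int (N (i + 4 + 1)) + 2 * int (N (i + 4 + 2)) =
      int (N i) - int (N (i + 1)) + 2 * int (N (i + 2)) + int (N (i + 4)) * 3"
      by (simp add: numeral_eq_Suc)
    then have "D (i + 4) = D i + int (N (i + 4))" unfolding D by simp
    moreover have "agreement (i + 4) = N (i + 4) + agreement i"
      using agreement_add_4[of i] block_start_values(3)[of "Suc i"] by (simp add: numeral_eq_Suc)
    ultimately show ?case using Suc by (simp add: numeral_eq_Suc)
  qed
  then show ?thesis by simp
qed

section \<open>Upper and lower bounds for the appearance\<close>

lemma early_occurrence:
  assumes "m \<le> agreement (Suc i) + 1"
  shows "\<exists>j' < N (i + 4). factor n j' m = factor n j m"
proof -
  let ?k = "Suc (Suc i)"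
  obtain t where t: "block_start ?k t \<le> j" "j < block_start ?k (Suc t)"
    using ex_block[OF strict_mono_block_start block_start_0] by blast
  obtain t' where t': "t' < 3" "n t' = n t"
    using prefix_letters by (cases "n t") (auto intro: that[of 0] that[of 1] that[of 2])
  define p where "p = j - block_start ?k t"
  have p: "p < block_length ?k (n t)" "j = block_start ?k t + p"
    using t unfolding p_def block_start_Suc by auto
  have agree: "n (block_start ?k t' + (p + u)) = n (block_start ?k t + (p + u))" if "u < m" for u
  proof (cases "p + u < block_length ?k (n t)")
    case True
    then show ?thesis using nth_block_eq[of t' t "p + u" ?k] t' by simp
  next
    case False
    define s where "s = p + u - block_length ?k (n t)"
    \<comment> \<open>As \<open>p\<close> lies inside its block, at most \<open>m - 1\<close>
      letters pass the boundary, which gives the extra 1 in the bound on \<open>m\<close>.\<close>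
    have s: "s < agreement (Suc i)" "p + u = block_length ?k (n t) + s"
      using False p that assms unfolding s_def by auto
    have "n (block_start ?k (Suc x) + s) = n s" for x
      using block_agreement[of "Suc i" "Suc x"] s by blast
    then show ?thesis
      using s t' block_start_Suc[of ?k t] block_start_Suc[of ?k t'] by (metis add.assoc)
  qed
  have "block_start ?k t' + p < block_start ?k (Suc t')"
    using p t' unfolding block_start_Suc by simp
  also have "\<dots> \<le> block_start ?k 3"
    using t' strict_mono_less_eq[OF strict_mono_block_start, of ?k "Suc t'" 3] by simp
  also have "\<dots> = N (i + 4)"
    using block_start_values(2)[of ?k] by (simp add: numeral_eq_Suc)
  finally have "block_start ?k t' + p < N (i + 4)" .
  moreover have "factor n (block_start ?k t' + p) m = factor n j m"
    using agree p by (intro nth_equalityI) (simp_all add: factor_def add.assoc)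
  ultimately show ?thesis by blast
qed

lemma late_factor:
  assumes "agreement i + 1 < m" and "factor n j m = factor n (N (i + 4) - 1) m"
  shows "N (i + 4) - 1 \<le> j"
proof -
  let ?k = "Suc i"
  define q where "q = N (i + 4) - 1"
  have N: "block_start ?k (Suc 3) = N (i + 4)"
    using block_start_values(3)[of ?k] by (simp add: numeral_eq_Suc)
  have "0 < N (i + 4)" using block_length_pos[of "i + 4" L0] block_length_L0 by simp
  then have q: "Suc q = N (i + 4)" by (simp add: q_def)
  have eq: "n (j + u) = n (q + u)" if "u < m" for u
  proof -
    have "factor n j m ! u = factor n q m ! u" using assms q_def by simp
    then show ?thesis using that by (simp add: factor_def)
  qed
  have "n q = (last_image ^^ ?k) L0"
    using last_of_block[of ?k 3] N q prefix_letters by (simp add: q_def)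
  then have 1: "n j = (last_image ^^ ?k) L0" using eq[of 0] assms by simp
  \<comment> \<open>Block 4 has the letter 0, not 1, so the agreement includes index
    \<open>agreement i\<close> itself.\<close>
  have "n (Suc q + s) = n s" if "s \<le> agreement i" for s
    using block_agreement[of i 4] prefix_letters that N q
    by (cases "s = agreement i") auto
  then have 2: "\<forall>s \<le> agreement i. n (Suc j + s) = n s"
    using eq[of "Suc s" for s] assms by auto
  obtain t where t: "Suc j = block_start ?k (Suc t)" "n t = L0" "n (Suc t) \<noteq> L1"
    using recognizability[OF 1 2] by blast
  \<comment> \<open>Among the first three letters only \<open>n 0\<close> is 0, and a 1 follows it;
    the first 00 is at positions 3 and 4.\<close>
  have "t \<noteq> 0" "t \<noteq> 1" "t \<noteq> 2"
    using t prefix_letters by (metis One_nat_def letter.distinct)+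
  then have "Suc 3 \<le> Suc t" by simp
  then have "block_start ?k (Suc 3) \<le> block_start ?k (Suc t)"
    using strict_mono_less_eq[OF strict_mono_block_start] by blast
  then show ?thesis using t N by simp
qed

end

theorem theorem9:
  fixes n :: "nat \<Rightarrow> letter" and m i :: nat
  assumes "is_fixed_point narayana_morphism n" and "n 0 = L0"
    and "m \<ge> 2" and "D i < int m" and "int m \<le> D (i + 1)"
  shows "int (appearance n m) = int (N (i + 4)) - 1"
proof -
  interpret narayana_word n by unfold_locales (use assms in auto)
  have lo: "agreement i + 1 < m" and hi: "m \<le> agreement (Suc i) + 1"
    using assms D_eq_agreement[of i] D_eq_agreement[of "i + 1"] by auto
  have pos: "0 < N (i + 4)" using block_length_pos[of "i + 4" L0] block_length_L0 by simp
  have "appearance n m = N (i + 4) - 1"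
    unfolding appearance_def
  proof (rule Least_equality)
    show "\<forall>u \<in> range (\<lambda>k. factor n k m). \<exists>j \<le> N (i + 4) - 1. factor n j m = u"
    proof
      fix u assume "u \<in> range (\<lambda>k. factor n k m)"
      then obtain k where "u = factor n k m" by blast
      then obtain j where "j < N (i + 4)" "factor n j m = u"
        using early_occurrence[OF hi] by blast
      then show "\<exists>j \<le> N (i + 4) - 1. factor n j m = u" using pos by (intro exI[of _ j]) simp
    qed
  next
    fix x assume "\<forall>u \<in> range (\<lambda>k. factor n k m). \<exists>j \<le> x. factor n j m = u"
    then obtain j where "j \<le> x" "factor n j m = factor n (N (i + 4) - 1) m" by blast
    then show "N (i + 4) - 1 \<le> x" using late_factor[OF lo] by fastforce
  qed
  then show ?thesis using pos by simp
qed

end
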